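(* Let $k\ge 1$ be an integer and let $G$ be a finite simple graph with $n\ge 2$ vertices and $m$ edges such that $\tau(G)\geq k$. If $G$ satisfies any one of the following properties, then $rmc_k(G)=m-k(n-2)$: (1) $G$ is triangle-free; (2) $\mathrm{diam}(G)\geq 3$; (3) $G$ has a cut vertex; (4) $G$ is not $(k+1)$-edge-connected.
   Context: An edge-coloring of a graph assigns a color to each edge; adjacent edges may receive the same color. A path is monochromatic if all its edges have the same color. For distinct vertices $u,v$ of an edge-colored graph, $k$ rainbow monochromatic $uv$-paths are $k$ edge-disjoint monochromatic $uv$-paths whose colors are pairwise different. An edge-coloring of $G$ is an $RMC_k$-coloring if every two distinct vertices of $G$ are connected by at least $k$ rainbow monochromatic paths. For a graph $G$ having an $RMC_k$-coloring, $rmc_k(G)$ is the maximum number of colors used in an $RMC_k$-coloring of $G$. For a partition $\mathcal{P}=\{V_1,\dots,V_t\}$ of $V(G)$ into nonempty sets, $G/\mathcal{P}$ is the graph obtained by deleting, for each $i$, all edges with both ends in $V_i$ and merging the vertices of $V_i$ into a single vertex (parallel edges are kept). Here $|G/\mathcal P|=|\mathcal P|$ is the number of vertices and $e(G/\mathcal P)$ the number of edges of $G/\mathcal P$. Define $\tau(G)=\min_{|\mathcal{P}|\geq 2}\frac{e(G/\mathcal{P})}{|G/\mathcal{P}|-1}$, the minimum being over all partitions of $V(G)$ with at least two parts. (A graph with $\tau(G)\ge k$ has an $RMC_k$-coloring, so $rmc_k(G)$ is defined.) *)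

theory Defs
  imports
    Complex_Main
    "HOL-Library.Disjoint_Sets"
    "HOL-Library.Extended_Nat"
    "HOL-Library.Multiset"
begin

text \<open>
  A graph is given by its vertex set \<open>V\<close> and its edge set \<open>E\<close>; an edge is the two-element
  set of its ends.
\<close>

definition fin_simple_graph :: "'a set \<Rightarrow> 'a set set \<Rightarrow> bool" where
  "fin_simple_graph V E \<longleftrightarrow> finite V \<and> (\<forall>e\<in>E. e \<subseteq> V \<and> card e = 2)"

text \<open>Paths are represented by their lists of vertices.\<close>

fun path_edges :: "'a list \<Rightarrow> 'a set set" where
  "path_edges (x # y # zs) = insert {x, y} (path_edges (y # zs))"
| "path_edges _ = {}"

definition uv_path :: "'a set \<Rightarrow> 'a set set \<Rightarrow> 'a \<Rightarrow> 'a list \<Rightarrow> 'a \<Rightarrow> bool" where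
  "uv_path V E u p v \<longleftrightarrow>
     p \<noteq> [] \<and> hd p = u \<and> last p = v \<and> distinct p \<and> set p \<subseteq> V \<and> path_edges p \<subseteq> E"


subsection \<open>Connectivity, diameter, triangles\<close>

definition graph_connected :: "'a set \<Rightarrow> 'a set set \<Rightarrow> bool" where
  "graph_connected V E \<longleftrightarrow> V \<noteq> {} \<and> (\<forall>u\<in>V. \<forall>v\<in>V. \<exists>p. uv_path V E u p v)"

definition graph_components :: "'a set \<Rightarrow> 'a set set \<Rightarrow> 'a set set" where
  "graph_components V E = {{v \<in> V. \<exists>p. uv_path V E u p v} | u. u \<in> V}"

definition cut_vertex :: "'a set \<Rightarrow> 'a set set \<Rightarrow> 'a \<Rightarrow> bool" where
  "cut_vertex V E v \<longleftrightarrow> v \<in> V \<and>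
     card (graph_components (V - {v}) {e \<in> E. v \<notin> e}) > card (graph_components V E)"

definition edge_connected :: "nat \<Rightarrow> 'a set \<Rightarrow> 'a set set \<Rightarrow> bool" where
  "edge_connected l V E \<longleftrightarrow>
     card V > 1 \<and> (\<forall>F. F \<subseteq> E \<and> card F < l \<longrightarrow> graph_connected V (E - F))"

text \<open>The distance between vertices in different components is \<open>\<infinity>\<close>, the infimum of
  the empty set.\<close>

definition graph_dist :: "'a set \<Rightarrow> 'a set set \<Rightarrow> 'a \<Rightarrow> 'a \<Rightarrow> enat" where
  "graph_dist V E u v = (INF p \<in> {p. uv_path V E u p v}. enat (length p - 1))"

definition graph_diam :: "'a set \<Rightarrow> 'a set set \<Rightarrow> enat" where
  "graph_diam V E = (SUP u \<in> V. SUP v \<in> V. graph_dist V E u v)"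

definition triangle_free :: "'a set set \<Rightarrow> bool" where
  "triangle_free E \<longleftrightarrow>
     \<not> (\<exists>x y z. distinct [x, y, z] \<and> {x, y} \<in> E \<and> {y, z} \<in> E \<and> {x, z} \<in> E)"


subsection \<open>The quotient by a partition and \<open>\<tau>\<close>\<close>

text \<open>
  The quotient by \<open>P\<close> is a multigraph with vertex set \<open>P\<close>. Each edge not contained in a part
  contributes one copy of the pair of parts that it joins, so parallel edges are counted with
  their multiplicity.
\<close>

definition quotient_edges :: "'a set set \<Rightarrow> 'a set set \<Rightarrow> 'a set set multiset" where
  "quotient_edges E P =
     image_mset (\<lambda>e. {X \<in> P. X \<inter> e \<noteq> {}}) (mset_set {e \<in> E. \<not> (\<exists>X\<in>P. e \<subseteq> X)})"

text \<open>For a finite graph with at least two vertices the minimum is over a finite nonempty set;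
  otherwise the value is unspecified.\<close>

definition tau :: "'a set \<Rightarrow> 'a set set \<Rightarrow> real" where
  "tau V E = Min {real (size (quotient_edges E P)) / (real (card P) - 1) | P.
                    partition_on V P \<and> card P \<ge> 2}"


subsection \<open>Rainbow monochromatic paths\<close>

text \<open>An edge-coloring is a function on edges, of which only the values on \<open>E\<close> matter. Natural
  numbers suffice as colors, since the graphs are finite.\<close>

definition monochromatic :: "('a set \<Rightarrow> nat) \<Rightarrow> 'a list \<Rightarrow> bool" where
  "monochromatic c p \<longleftrightarrow> (\<forall>e\<in>path_edges p. \<forall>f\<in>path_edges p. c e = c f)"

text \<open>Only meaningful for a monochromatic path with at least one edge.\<close>

definition path_color :: "('a set \<Rightarrow> nat) \<Rightarrow> 'a list \<Rightarrow> nat" where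
  "path_color c p = the_elem (c ` path_edges p)"

definition rainbow_mono_paths ::
    "'a set \<Rightarrow> 'a set set \<Rightarrow> ('a set \<Rightarrow> nat) \<Rightarrow> 'a \<Rightarrow> 'a \<Rightarrow> 'a list set \<Rightarrow> bool" where
  "rainbow_mono_paths V E c u v S \<longleftrightarrow>
     (\<forall>p\<in>S. uv_path V E u p v \<and> monochromatic c p) \<and>
     (\<forall>p\<in>S. \<forall>q\<in>S. p \<noteq> q \<longrightarrow>
        path_edges p \<inter> path_edges q = {} \<and> path_color c p \<noteq> path_color c q)"

definition RMC_coloring :: "nat \<Rightarrow> 'a set \<Rightarrow> 'a set set \<Rightarrow> ('a set \<Rightarrow> nat) \<Rightarrow> bool" where
  "RMC_coloring k V E c \<longleftrightarrow>
     (\<forall>u\<in>V. \<forall>v\<in>V. u \<noteq> v \<longrightarrow>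
        (\<exists>S. finite S \<and> card S \<ge> k \<and> rainbow_mono_paths V E c u v S))"

text \<open>Unspecified (\<open>Max {}\<close>) if there is no such coloring.\<close>

definition rmc :: "nat \<Rightarrow> 'a set \<Rightarrow> 'a set set \<Rightarrow> nat" where
  "rmc k V E = Max {card (c ` E) | c. RMC_coloring k V E c}"

end

theory Submission
  imports Defs
begin

text \<open>
  Write \<open>n\<close> and \<open>m\<close> for the numbers of vertices and edges. A coloring of the whole edge set
  uses \<open>m\<close> minus the sum of \<open>j - 1\<close> over its color classes, where \<open>j\<close> is the size of the
  class; call this \<open>j - 1\<close> the cost of the color. The theorem says that the least total cost of
  an \<open>RMC\<^sub>k\<close>-coloring is \<open>k * (n - 2)\<close>.

  This cost is attained by giving each of \<open>k\<close> edge-disjoint spanning trees a color of its own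
  and every remaining edge a new color. Such trees exist by the theorem of Nash-Williams and
  Tutte (\<open>exists_spanning_tree_packing\<close>), since \<open>\<tau>(G) \<ge> k\<close> is exactly its hypothesis. For its
  proof take \<open>k\<close> edge-disjoint forests with as many edges as possible, and let \<open>D\<close> be the set
  of the edges that can be left unused after a sequence of exchanges, each of which brings an
  unused edge into a forest and drops an edge of the cycle that arises. All of these packings
  are maximum, so each cycle that arises consists of edges of \<open>D\<close>. It follows that every
  forest joins within \<open>D\<close> all pairs of vertices that \<open>D\<close> joins. The partition into the
  components of \<open>D\<close> then turns the hypothesis into the statement that all forests are spanning.

  For the converse, each of \<open>n - 2\<close> vertices is assigned \<open>k\<close> colors, in such a way that no color
  is assigned to more vertices than it costs (\<open>card_colors_bound\<close>). If a vertex is assigned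
  colors that join it to a fixed root, then the vertices with the same color lie in the component
  of the root in that color, which has at least as many edges as further vertices
  (\<open>card_reached_le_card_edges\<close>). This bounds the number of assignments by \<open>j\<close>, so in each color
  one edge has to be saved, and the four properties do this in three ways. The ends of an edge
  of a triangle-free graph, and two vertices at distance at least 3, have no common neighbor.
  Taking both as roots, and for each vertex the one that it is not adjacent to, saves the first
  edge at the root (\<open>card_colors_no_common_neighbor\<close>). A cut vertex is a root for all
  monochromatic paths between two fixed sides, and each color that is used reaches beyond the
  vertices that are assigned it (\<open>card_colors_cut_vertex\<close>). Finally, if at most \<open>k\<close> edges
  separate the graph, then each of the \<open>k\<close> colors on them spans the graph
  (\<open>card_colors_edge_cut\<close>).
\<close>

section \<open>Connectivity through a set of edges\<close>

definition conn :: "'a set set \<Rightarrow> 'a \<Rightarrow> 'a \<Rightarrow> bool" where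
  "conn A = (\<lambda>x y. {x, y} \<in> A)\<^sup>*\<^sup>*"

lemma conn_refl [simp]: "conn A x x"
  by (simp add: conn_def)

lemma conn_edge: "{x, y} \<in> A \<Longrightarrow> conn A x y"
  by (auto simp: conn_def)

lemma conn_trans [trans]: "conn A x y \<Longrightarrow> conn A y z \<Longrightarrow> conn A x z"
  unfolding conn_def by (rule rtranclp_trans)

lemma conn_sym: "conn A x y \<Longrightarrow> conn A y x"
proof -
  have "symp (\<lambda>x y. {x, y} \<in> A)"
    by (auto intro!: sympI simp: insert_commute)
  then show "conn A x y \<Longrightarrow> conn A y x"
    unfolding conn_def by (meson sympD symp_rtranclp)
qed

lemma conn_induct [consumes 1, case_names refl step]:
  assumes "conn A x y" "P x"
    and "\<And>y z. conn A x y \<Longrightarrow> {y, z} \<in> A \<Longrightarrow> P y \<Longrightarrow> P z"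
  shows "P y"
  using assms unfolding conn_def by (rule rtranclp_induct)

lemma conn_closed:
  assumes "conn A x y" "\<And>a b. {a, b} \<in> A \<Longrightarrow> conn B a b"
  shows "conn B x y"
  using assms(1) by (induction rule: conn_induct) (auto intro: conn_trans assms(2))

lemma conn_mono: "conn A x y \<Longrightarrow> A \<subseteq> B \<Longrightarrow> conn B x y"
  by (erule conn_closed) (auto intro: conn_edge)

lemma conn_insert_absorb:
  assumes "conn A x y" "conn (insert {x, y} A) a b"
  shows "conn A a b"
  using assms(2)
proof (rule conn_closed)
  fix c d assume "{c, d} \<in> insert {x, y} A"
  then show "conn A c d"
    using assms(1) conn_sym conn_edge by (metis doubleton_eq_iff insert_iff)
qed

lemma conn_insert_cases:
  assumes "conn (insert {x, y} A) a b"
  shows "conn A a b \<or> conn A a x \<and> conn A y b \<or> conn A a y \<and> conn A x b"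
  using assms
proof (induction rule: conn_induct)
  case (step b c)
  then show ?case
    by (metis conn_edge conn_refl conn_sym conn_trans doubleton_eq_iff insert_iff)
qed simp

text \<open>The exchange property of the cycle matroid.\<close>

lemma conn_exchange:
  assumes "conn (insert {a, b} A) x y" "\<not> conn A x y"
  shows "conn (insert {x, y} A) a b"
proof -
  have e: "conn (insert {x, y} A) x y"
    by (simp add: conn_edge)
  have "conn A x a \<and> conn A b y \<or> conn A x b \<and> conn A a y"
    using conn_insert_cases assms by metis
  then have "conn (insert {x, y} A) x a \<and> conn (insert {x, y} A) b y \<or>
      conn (insert {x, y} A) x b \<and> conn (insert {x, y} A) a y"
    by (meson conn_mono subset_insertI)
  then show ?thesis
    using e by (meson conn_sym conn_trans)
qed

lemma conn_imp_boundary_edge: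
  assumes "conn A x y" "x \<in> X" "y \<notin> X"
  obtains a b where "{a, b} \<in> A" "a \<in> X" "b \<notin> X"
proof -
  have "y \<in> X \<or> (\<exists>a b. {a, b} \<in> A \<and> a \<in> X \<and> b \<notin> X)"
    using assms(1) by (induction rule: conn_induct) (use assms(2) in auto)
  then show ?thesis
    using assms(3) that by blast
qed

lemma path_edges_Cons: "p \<noteq> [] \<Longrightarrow> path_edges (x # p) = insert {x, hd p} (path_edges p)"
  by (cases p) auto

lemma path_edges_nonempty: "p \<noteq> [] \<Longrightarrow> hd p \<noteq> last p \<Longrightarrow> path_edges p \<noteq> {}"
  by (induction p rule: path_edges.induct) auto

lemma path_edges_append_subset: "path_edges q \<subseteq> path_edges (p @ q)"
proof (induction p)
  case (Cons x p)
  then show ?case by (cases "p @ q") auto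
qed simp

lemma path_color_eq:
  assumes "e \<in> path_edges p" "monochromatic c p"
  shows "path_color c p = c e"
proof -
  have "c ` path_edges p = {c e}"
    using assms unfolding monochromatic_def by blast
  then show ?thesis
    by (simp add: path_color_def)
qed

lemma path_imp_conn:
  "p \<noteq> [] \<Longrightarrow> path_edges p \<subseteq> A \<Longrightarrow> conn A (hd p) (last p)"
proof (induction p)
  case (Cons x p)
  show ?case
  proof (cases "p = []")
    case False
    then have "conn A (hd p) (last p)" "conn A x (hd p)"
      using Cons by (auto simp: path_edges_Cons intro: conn_edge)
    then show ?thesis
      using False by (auto intro: conn_trans)
  qed simp
qed simp

lemma uv_path_imp_conn: "uv_path V A u p v \<Longrightarrow> conn A u v"
  unfolding uv_path_def using path_imp_conn by metis

lemma conn_imp_uv_path: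
  assumes "conn A u v" "u \<in> V" "v \<in> V" "\<And>e. e \<in> A \<Longrightarrow> e \<subseteq> V"
  shows "\<exists>p. uv_path V A u p v"
proof -
  have "conn A v u"
    using assms(1) by (rule conn_sym)
  then show ?thesis
  proof (induction rule: conn_induct)
    case refl
    have "uv_path V A v [v] v"
      using assms(3) by (simp add: uv_path_def)
    then show ?case by blast
  next
    case (step y x)
    then obtain p where p: "uv_path V A y p v" by blast
    have xV: "x \<in> V"
      using step.hyps(2) assms(4) by blast
    show ?case
    proof (cases "x \<in> set p")
      case True
      then obtain a b where ab: "p = a @ x # b"
        by (meson split_list)
      then have "uv_path V A x (x # b) v"
        using p path_edges_append_subset[of "x # b" a] unfolding uv_path_def by auto
      then show ?thesis by blast
    next
      case False
      then have "uv_path V A x (x # p) v"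
        using p step.hyps(2) xV unfolding uv_path_def
        by (auto simp: path_edges_Cons insert_commute)
      then show ?thesis by blast
    qed
  qed
qed

text \<open>
  Growing outwards from the roots \<open>R\<close>, each edge can reach at most one new vertex. In the
  induction an edge is removed, and the new vertex that it reached becomes a root.
\<close>

lemma card_reached_le_card_edges:
  assumes "finite A" "finite X" "X \<inter> R = {}" "\<And>x. x \<in> X \<Longrightarrow> \<exists>r\<in>R. conn A r x"
    and "\<And>e. e \<in> A \<Longrightarrow> \<exists>a b. e = {a, b}"
  shows "card X \<le> card A"
  using assms
proof (induction A arbitrary: X R rule: finite_induct)
  case empty
  have "conn {} r x \<Longrightarrow> r = x" for r x :: 'a
    by (auto elim: conn_induct)
  then have "X = {}"
    using empty by blast
  then show ?case by simp
next
  case (insert e A)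
  obtain a b where e: "e = {a, b}"
    using insert.prems by blast
  have "\<exists>b. \<forall>x\<in>X. \<exists>r\<in>insert b R. conn A r x"
  proof (cases "\<exists>r\<in>R. conn A r a")
    case True
    have "\<exists>r\<in>insert b R. conn A r x" if "x \<in> X" for x
      using insert.prems(3)[OF that] True conn_insert_cases conn_trans e
      by (metis conn_sym insert_iff)
    then show ?thesis by blast
  next
    case False
    have "\<exists>r\<in>insert a R. conn A r x" if "x \<in> X" for x
      using insert.prems(3)[OF that] False conn_insert_cases conn_trans e
      by (metis conn_sym insert_iff)
    then show ?thesis by blast
  qed
  then obtain z where z: "\<forall>x\<in>X. \<exists>r\<in>insert z R. conn A r x" by blast
  have "card (X - {z}) \<le> card A"
    using insert.IH[of "X - {z}" "insert z R"] insert.prems z by auto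
  moreover have "card X \<le> Suc (card (X - {z}))"
    using insert.prems(1) card_Suc_Diff1[of X z] by (cases "z \<in> X") simp_all
  ultimately show ?case
    using insert.hyps by simp
qed

lemma fin_simple_graph_edge:
  "fin_simple_graph V E \<Longrightarrow> e \<in> E \<Longrightarrow> e \<subseteq> V \<and> (\<exists>a b. e = {a, b})"
  unfolding fin_simple_graph_def by (metis card_2_iff)

lemma fin_simple_graph_finite_edges: "fin_simple_graph V E \<Longrightarrow> finite E"
  by (rule finite_subset[of E "Pow V"]) (auto simp: fin_simple_graph_def)

section \<open>Forests\<close>

definition forest :: "'a set set \<Rightarrow> bool" where
  "forest A \<longleftrightarrow> (\<forall>x y. {x, y} \<in> A \<longrightarrow> \<not> conn (A - {{x, y}}) x y)"

lemma forest_mono: "forest A \<Longrightarrow> B \<subseteq> A \<Longrightarrow> forest B"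
  unfolding forest_def by (meson Diff_mono conn_mono order_refl subsetD)

lemma forest_insert:
  assumes "forest A" "\<not> conn A x y"
  shows "forest (insert {x, y} A)"
  unfolding forest_def
proof (intro allI impI notI)
  fix a b
  assume ab: "{a, b} \<in> insert {x, y} A" "conn (insert {x, y} A - {{a, b}}) a b"
  show False
  proof (cases "{a, b} = {x, y}")
    case True
    then have "conn A a b"
      using ab(2) by (auto intro: conn_mono)
    then show False
      using True assms(2) conn_sym by (metis doubleton_eq_iff)
  next
    case False
    let ?B = "A - {{a, b}}"
    have "insert {x, y} A - {{a, b}} = insert {x, y} ?B"
      using False by auto
    then have "conn (insert {a, b} ?B) x y"
      using ab False assms(1) conn_exchange[of x y ?B a b] by (auto simp: forest_def)
    then have "conn A x y"
      using ab(1) False by (simp add: insert_absorb)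
    then show False
      using assms(2) by simp
  qed
qed

text \<open>
  The edges whose removal from \<open>A\<close> separates \<open>x\<close> from \<open>y\<close> form the path of the forest
  between them: no edge of a minimal connecting set \<open>B\<close> can be bypassed in \<open>A\<close>, since the
  bypass would close a cycle.
\<close>

lemma forest_conn_essential_edges:
  assumes "forest A" "finite A" "conn A x y" "\<And>e. e \<in> A \<Longrightarrow> \<exists>a b. e = {a, b}"
  shows "conn {f \<in> A. \<not> conn (A - {f}) x y} x y"
proof -
  let ?P = "\<lambda>B. B \<subseteq> A \<and> conn B x y"
  have "finite {B. ?P B}"
    using assms(2) by (auto intro: finite_subset[of _ "Pow A"])
  moreover have "A \<in> {B. ?P B}"
    using assms(3) by simp
  ultimately obtain B where B: "?P B" and min: "\<And>C. ?P C \<Longrightarrow> C \<subseteq> B \<Longrightarrow> B = C"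
    using finite_has_minimal2[of "{B. ?P B}" A] by (metis (lifting) mem_Collect_eq)
  have "\<not> conn (A - {f}) x y" if f: "f \<in> B" for f
  proof
    assume *: "conn (A - {f}) x y"
    obtain a b where ab: "f = {a, b}"
      using assms(4) f B by blast
    have "\<not> conn (B - {f}) x y"
      using min[of "B - {f}"] B f by blast
    then have "conn (insert {x, y} (B - {f})) a b"
      using conn_exchange[of a b "B - {f}" x y] B f ab by (simp add: insert_absorb)
    then have "conn (insert {x, y} (A - {f})) a b"
      using B by (auto intro: conn_mono)
    then have "conn (A - {f}) a b"
      using * conn_insert_absorb by metis
    then show False
      using assms(1) f B ab unfolding forest_def by blast
  qed
  then show ?thesis
    using B by (auto intro: conn_mono)
qed

definition comps :: "'a set \<Rightarrow> 'a set set \<Rightarrow> 'a set set" where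
  "comps V A = (\<lambda>x. {y \<in> V. conn A x y}) ` V"

lemma comps_eq_iff:
  assumes "x \<in> V" "y \<in> V"
  shows "{z \<in> V. conn A x z} = {z \<in> V. conn A y z} \<longleftrightarrow> conn A x y"
proof
  assume "{z \<in> V. conn A x z} = {z \<in> V. conn A y z}"
  then have "y \<in> {z \<in> V. conn A x z}"
    using assms by simp
  then show "conn A x y" by simp
next
  assume "conn A x y"
  then have "conn A x z \<longleftrightarrow> conn A y z" for z
    using conn_sym conn_trans by metis
  then show "{z \<in> V. conn A x z} = {z \<in> V. conn A y z}" by simp
qed

lemma finite_comps [simp]: "finite V \<Longrightarrow> finite (comps V A)"
  by (simp add: comps_def)

lemma partition_on_comps: "partition_on V (comps V A)"
proof (rule partition_onI)
  show "\<Union> (comps V A) = V"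
    by (auto simp: comps_def)
  show "{} \<notin> comps V A"
    by (auto simp: comps_def)
  fix X Y assume "X \<in> comps V A" "Y \<in> comps V A" "X \<noteq> Y"
  then obtain x y where xy: "x \<in> V" "y \<in> V" "X = {z \<in> V. conn A x z}" "Y = {z \<in> V. conn A y z}"
      "\<not> conn A x y"
    using comps_eq_iff[of _ V _ A] unfolding comps_def by blast
  then have "\<not> (conn A x z \<and> conn A y z)" for z
    using conn_sym conn_trans by metis
  then show "disjnt X Y"
    using xy by (auto simp: disjnt_def)
qed

lemma card_comps_empty: "card (comps V {}) = card V"
proof -
  have "x = y" if "conn {} x y" for x y :: 'a
    using that by (auto elim: conn_induct)
  then have "inj_on (\<lambda>x. {y \<in> V. conn {} x y}) V"
    by (intro inj_onI) (simp add: comps_eq_iff)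
  then show ?thesis
    by (simp add: comps_def card_image)
qed

lemma card_comps_insert:
  assumes "finite V" "x \<in> V" "y \<in> V" "\<not> conn A x y"
  shows "Suc (card (comps V (insert {x, y} A))) = card (comps V A)"
proof -
  let ?C = "\<lambda>A z. {w \<in> V. conn A z w}"
  let ?B = "insert {x, y} A"
  let ?R = "comps V A - {?C A x, ?C A y}"
  have AB: "conn A a b \<Longrightarrow> conn ?B a b" for a b
    by (auto intro: conn_mono)
  have xy: "conn ?B x y"
    by (simp add: conn_edge)
  have near: "?C ?B z = ?C A x \<union> ?C A y" if "conn A x z \<or> conn A y z" for z
  proof -
    have "conn ?B z w \<longleftrightarrow> conn A x w \<or> conn A y w" for w
      using that conn_insert_cases[of x y A z w] AB xy conn_sym conn_trans by metis
    then show ?thesis by auto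
  qed
  have far: "?C ?B z = ?C A z" if "\<not> conn A x z" "\<not> conn A y z" for z
  proof -
    have "conn ?B z w \<longleftrightarrow> conn A z w" for w
      using that conn_insert_cases[of x y A z w] AB conn_sym by metis
    then show ?thesis by auto
  qed
  have "comps V ?B = insert (?C A x \<union> ?C A y) ?R"
  proof (intro equalityI subsetI)
    fix X assume "X \<in> comps V ?B"
    then obtain z where z: "z \<in> V" "X = ?C ?B z"
      by (auto simp: comps_def)
    show "X \<in> insert (?C A x \<union> ?C A y) ?R"
    proof (cases "conn A x z \<or> conn A y z")
      case True
      then show ?thesis using near z by blast
    next
      case False
      then have "?C A z \<in> ?R"
        using z comps_eq_iff assms by (auto simp: comps_def)
      then show ?thesis using far False z by auto
    qed
  next
    fix X assume "X \<in> insert (?C A x \<union> ?C A y) ?R"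
    then consider "X = ?C ?B x" | z where "z \<in> V" "X = ?C A z" "X \<noteq> ?C A x" "X \<noteq> ?C A y"
      using near[of x] by (auto simp: comps_def)
    then show "X \<in> comps V ?B"
    proof cases
      case 1
      then show ?thesis using assms by (auto simp: comps_def)
    next
      case 2
      then have "X = ?C ?B z"
        using far[of z] comps_eq_iff assms by metis
      then show ?thesis using 2 by (auto simp: comps_def)
    qed
  qed
  moreover have "?C A x \<union> ?C A y \<notin> ?R"
  proof
    assume "?C A x \<union> ?C A y \<in> ?R"
    then obtain z where z: "z \<in> V" "?C A x \<union> ?C A y = ?C A z"
      by (auto simp: comps_def)
    have "x \<in> ?C A x \<union> ?C A y" "y \<in> ?C A x \<union> ?C A y"
      using assms(2,3) by simp_all
    then have "conn A z x" "conn A z y"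
      unfolding z(2) by simp_all
    then show False
      using assms(4) conn_sym conn_trans by metis
  qed
  moreover have "?C A x \<noteq> ?C A y"
    using comps_eq_iff assms by metis
  moreover have "?C A x \<in> comps V A" "?C A y \<in> comps V A"
    using assms by (auto simp: comps_def)
  then have "card {?C A x, ?C A y} \<le> card (comps V A)"
      and "card ?R = card (comps V A) - card {?C A x, ?C A y}"
    using assms(1) by (auto intro!: card_mono card_Diff_subset)
  ultimately show ?thesis
    using assms(1) by simp
qed

text \<open>Every edge of a forest joins two components of the edges added before it.\<close>

lemma card_comps_forest:
  assumes "finite V" "finite C" "forest (B \<union> C)" "B \<inter> C = {}"
    and "\<And>e. e \<in> C \<Longrightarrow> e \<subseteq> V \<and> (\<exists>a b. e = {a, b})"
  shows "card (comps V (B \<union> C)) + card C = card (comps V B)"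
  using assms(2-)
proof (induction C rule: finite_induct)
  case (insert e C)
  obtain a b where e: "e = {a, b}" "a \<in> V" "b \<in> V"
    using insert.prems(3)[of e] by auto
  have "B \<union> insert e C - {{a, b}} = B \<union> C"
    using insert.hyps(2) insert.prems(2) e by auto
  moreover have "\<not> conn (B \<union> insert e C - {{a, b}}) a b"
    using insert.prems(1) e unfolding forest_def by blast
  ultimately have "\<not> conn (B \<union> C) a b"
    by simp
  then have "Suc (card (comps V (insert e (B \<union> C)))) = card (comps V (B \<union> C))"
    using card_comps_insert assms(1) e by metis
  moreover have "card (comps V (B \<union> C)) + card C = card (comps V B)"
    using insert.prems by (intro insert.IH forest_mono[OF insert.prems(1)]) auto
  ultimately show ?case
    using insert.hyps by simp
qed simp

section \<open>Packing spanning trees\<close>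

definition forest_packing :: "nat \<Rightarrow> 'a set set \<Rightarrow> (nat \<Rightarrow> 'a set set) \<Rightarrow> bool" where
  "forest_packing k E F \<longleftrightarrow>
     (\<forall>i<k. F i \<subseteq> E \<and> forest (F i)) \<and> (\<forall>i<k. \<forall>j<k. i \<noteq> j \<longrightarrow> F i \<inter> F j = {})"

definition packing_size :: "nat \<Rightarrow> (nat \<Rightarrow> 'a set set) \<Rightarrow> nat" where
  "packing_size k F = (\<Sum>i<k. card (F i))"

definition maximum_packing :: "nat \<Rightarrow> 'a set set \<Rightarrow> (nat \<Rightarrow> 'a set set) \<Rightarrow> bool" where
  "maximum_packing k E F \<longleftrightarrow> forest_packing k E F \<and>
     (\<forall>G. forest_packing k E G \<longrightarrow> packing_size k G \<le> packing_size k F)"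

definition unused :: "nat \<Rightarrow> 'a set set \<Rightarrow> (nat \<Rightarrow> 'a set set) \<Rightarrow> 'a set set" where
  "unused k E F = E - (\<Union>i<k. F i)"

text \<open>
  An unused edge enters a forest and replaces an edge of the cycle that it closes. The edges of
  the forest on this cycle are those whose removal separates the ends of the new edge.
\<close>

definition exchange ::
    "nat \<Rightarrow> 'a set set \<Rightarrow> (nat \<Rightarrow> 'a set set) \<Rightarrow> (nat \<Rightarrow> 'a set set) \<Rightarrow> bool" where
  "exchange k E F G \<longleftrightarrow> (\<exists>i<k. \<exists>x y f. {x, y} \<in> unused k E F \<and> f \<in> F i \<and>
     conn (F i) x y \<and> \<not> conn (F i - {f}) x y \<and> G = F(i := insert {x, y} (F i - {f})))"

definition exchange_edges :: "nat \<Rightarrow> 'a set set \<Rightarrow> (nat \<Rightarrow> 'a set set) \<Rightarrow> 'a set set" where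
  "exchange_edges k E F = \<Union> {unused k E G | G. (exchange k E)\<^sup>*\<^sup>* F G}"

lemma packing_size_upd:
  assumes "i < k"
  shows "packing_size k (F(i := A)) + card (F i) = packing_size k F + card A"
proof -
  have "(\<Sum>j<k. card ((F(i := A)) j)) = card A + (\<Sum>j\<in>{..<k} - {i}. card (F j))"
    using assms by (subst sum.remove[of _ i]) auto
  moreover have "(\<Sum>j<k. card (F j)) = card (F i) + (\<Sum>j\<in>{..<k} - {i}. card (F j))"
    using assms by (subst sum.remove[of _ i]) auto
  ultimately show ?thesis
    by (simp add: packing_size_def)
qed

lemma exists_maximum_packing:
  assumes "finite E"
  shows "\<exists>F. maximum_packing k E F"
proof -
  have "forest_packing k E (\<lambda>_. {})"
    by (simp add: forest_packing_def forest_def)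
  moreover have "packing_size k F < Suc (k * card E)" if "forest_packing k E F" for F
  proof -
    have "packing_size k F \<le> (\<Sum>i<k. card E)"
      unfolding packing_size_def using that assms
      by (intro sum_mono card_mono) (auto simp: forest_packing_def)
    then show ?thesis by simp
  qed
  ultimately show ?thesis
    unfolding maximum_packing_def
    using ex_has_greatest_nat[of "forest_packing k E" _ "packing_size k"] by metis
qed

lemma forest_packing_upd:
  assumes "forest_packing k E F" "e \<in> unused k E F" "forest (insert e B)" "B \<subseteq> F i" "i < k"
  shows "forest_packing k E (F(i := insert e B))"
  unfolding forest_packing_def
proof (intro conjI allI impI)
  let ?G = "F(i := insert e B)"
  have F: "F j \<subseteq> E" "forest (F j)" "j < k \<Longrightarrow> l < k \<Longrightarrow> j \<noteq> l \<Longrightarrow> F j \<inter> F l = {}"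
    if "j < k" for j l
    using assms(1) that by (auto simp: forest_packing_def)
  have e: "e \<in> E" "j < k \<Longrightarrow> e \<notin> F j" for j
    using assms(2) by (auto simp: unused_def)
  fix j assume j: "j < k"
  show "?G j \<subseteq> E"
    using F(1)[OF j] F(1)[OF assms(5)] e(1) assms(4) by auto
  show "forest (?G j)"
    using F(2)[OF j] assms(3) by auto
  fix l assume l: "l < k" "j \<noteq> l"
  then show "?G j \<inter> ?G l = {}"
    using F(3)[OF j j l] e(2)[OF j] e(2)[OF l(1)] l(2) assms(4) by auto
qed

lemma maximum_packing_conn_unused:
  assumes "maximum_packing k E F" "{x, y} \<in> unused k E F" "i < k" "finite E"
  shows "conn (F i) x y"
proof (rule ccontr)
  assume "\<not> conn (F i) x y"
  then have "forest_packing k E (F(i := insert {x, y} (F i)))"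
    using assms
    by (intro forest_packing_upd forest_insert)
      (auto simp: maximum_packing_def forest_packing_def)
  moreover have "card (insert {x, y} (F i)) = Suc (card (F i))"
    using assms finite_subset
    by (subst card_insert_disjoint)
      (auto simp: unused_def maximum_packing_def forest_packing_def)
  ultimately show False
    using assms packing_size_upd[of i k F "insert {x, y} (F i)"]
    unfolding maximum_packing_def by fastforce
qed

lemma maximum_packing_exchange:
  assumes "maximum_packing k E F" "exchange k E F G" "finite E"
  shows "maximum_packing k E G"
proof -
  obtain i x y f where *: "i < k" "{x, y} \<in> unused k E F" "f \<in> F i"
      "\<not> conn (F i - {f}) x y" "G = F(i := insert {x, y} (F i - {f}))"
    using assms(2) unfolding exchange_def by blast
  have F: "F i \<subseteq> E" "forest (F i)"
    using assms(1) * by (auto simp: maximum_packing_def forest_packing_def)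
  have "forest (insert {x, y} (F i - {f}))"
    using * F by (intro forest_insert) (auto intro: forest_mono)
  then have "forest_packing k E G"
    unfolding *(5) using assms(1) *(1,2)
    by (intro forest_packing_upd) (auto simp: maximum_packing_def)
  moreover have "card (insert {x, y} (F i - {f})) = card (F i)"
  proof -
    have "{x, y} \<notin> F i" "finite (F i)"
      using * F assms(3) finite_subset by (auto simp: unused_def)
    then show ?thesis
      using *(3) card_Suc_Diff1[of "F i" f] by simp
  qed
  then have "packing_size k G = packing_size k F"
    using packing_size_upd[of i k F] * by (metis add_right_cancel)
  ultimately show ?thesis
    using assms(1) by (simp add: maximum_packing_def)
qed

lemma maximum_packing_exchanges:
  assumes "(exchange k E)\<^sup>*\<^sup>* F G" "maximum_packing k E F" "finite E"
  shows "maximum_packing k E G"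
  using assms(1)
proof (induction rule: rtranclp_induct)
  case base
  then show ?case using assms(2) .
next
  case (step H G)
  then show ?case using maximum_packing_exchange assms(3) by blast
qed

text \<open>
  Since the packings reached by exchanges are maximum, an unused edge closes a cycle with each
  of their forests. Every edge of this cycle can itself be made unused by an exchange, so the
  whole cycle consists of exchange edges.
\<close>

lemma conn_unused_exchange_edges:
  assumes "maximum_packing k E F" "(exchange k E)\<^sup>*\<^sup>* F G" "{x, y} \<in> unused k E G" "i < k"
    and "finite E" "\<And>e. e \<in> E \<Longrightarrow> \<exists>a b. e = {a, b}"
  shows "conn (G i \<inter> exchange_edges k E F) x y"
proof -
  have G: "maximum_packing k E G"
    using maximum_packing_exchanges assms by metis
  then have Gi: "G i \<subseteq> E" "forest (G i)"
    using assms(4) by (auto simp: maximum_packing_def forest_packing_def)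
  have xy: "conn (G i) x y"
    using maximum_packing_conn_unused G assms by metis
  have "f \<in> exchange_edges k E F" if f: "f \<in> G i" "\<not> conn (G i - {f}) x y" for f
  proof -
    let ?H = "G(i := insert {x, y} (G i - {f}))"
    have "exchange k E G ?H"
      unfolding exchange_def using assms f xy by blast
    moreover have "f \<in> unused k E ?H"
    proof -
      have "f \<noteq> {x, y}"
        using f(1) assms(3,4) by (auto simp: unused_def)
      moreover have "f \<notin> G j" if "j < k" "j \<noteq> i" for j
        using G f(1) assms(4) that unfolding maximum_packing_def forest_packing_def by blast
      ultimately show ?thesis
        using f(1) Gi by (auto simp: unused_def)
    qed
    ultimately show ?thesis
      unfolding exchange_edges_def using assms(2) by (blast intro: rtranclp.rtrancl_into_rtrancl)
  qed
  then have "{f \<in> G i. \<not> conn (G i - {f}) x y} \<subseteq> G i \<inter> exchange_edges k E F"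
    by blast
  moreover have "conn {f \<in> G i. \<not> conn (G i - {f}) x y} x y"
  proof (rule forest_conn_essential_edges)
    show "finite (G i)"
      using Gi(1) assms(5) by (rule finite_subset)
    show "\<exists>a b. e = {a, b}" if "e \<in> G i" for e
      using Gi(1) that assms(6) by blast
  qed (use Gi xy in auto)
  ultimately show ?thesis
    by (rule conn_mono[rotated])
qed

text \<open>
  The only edge that an exchange adds joins two vertices that were already joined within the
  exchange edges.
\<close>

lemma conn_before_exchanges:
  assumes "maximum_packing k E F" "(exchange k E)\<^sup>*\<^sup>* F G" "i < k"
    and "finite E" "\<And>e. e \<in> E \<Longrightarrow> \<exists>a b. e = {a, b}"
    and "conn (G i \<inter> exchange_edges k E F) a b"
  shows "conn (F i \<inter> exchange_edges k E F) a b"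
  using assms(2,6)
proof (induction arbitrary: a b rule: rtranclp_induct)
  case (step G H)
  let ?D = "exchange_edges k E F"
  obtain j x y f where *: "j < k" "{x, y} \<in> unused k E G" "H = G(j := insert {x, y} (G j - {f}))"
    using step.hyps(2) unfolding exchange_def by blast
  have "conn (G i \<inter> ?D) a b"
    using step.prems
  proof (rule conn_closed)
    fix c d assume cd: "{c, d} \<in> H i \<inter> ?D"
    show "conn (G i \<inter> ?D) c d"
    proof (cases "{c, d} \<in> G i")
      case True
      then show ?thesis using cd by (auto intro: conn_edge)
    next
      case False
      then have "{c, d} = {x, y}"
        using cd * by (auto split: if_splits)
      then have "{c, d} \<in> unused k E G"
        using * by metis
      then show ?thesis
        using conn_unused_exchange_edges assms(1,3,4,5) step.hyps(1) by metis
    qed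
  qed
  then show ?case
    by (rule step.IH)
qed

text \<open>
  The theorem of Nash-Williams and Tutte. Every forest of a maximum packing has, within the
  exchange edges \<open>D\<close>, the connectivity of \<open>D\<close> itself. Hence each forest meets the quotient by
  the components of \<open>D\<close> in a forest, and the edges between different components all lie in one
  of these \<open>k\<close> forests, so counting them against the hypothesis leaves no room for a forest that
  is not spanning.
\<close>

theorem exists_spanning_tree_packing:
  assumes "finite V" "V \<noteq> {}" "\<And>e. e \<in> E \<Longrightarrow> e \<subseteq> V \<and> (\<exists>a b. e = {a, b})"
    and crossing: "\<And>P. partition_on V P \<Longrightarrow>
      k * (card P - 1) \<le> card {e \<in> E. \<not> (\<exists>X\<in>P. e \<subseteq> X)}"
  obtains F where "forest_packing k E F" "\<And>i x y. i < k \<Longrightarrow> x \<in> V \<Longrightarrow> y \<in> V \<Longrightarrow> conn (F i) x y"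
    "\<And>i. i < k \<Longrightarrow> card (F i) = card V - 1"
proof -
  have "finite E"
    using assms(1,3) by (intro finite_subset[of E "Pow V"]) auto
  then obtain F where F: "maximum_packing k E F"
    using exists_maximum_packing by blast
  define D where "D = exchange_edges k E F"
  let ?P = "comps V D"
  have edge: "\<And>e. e \<in> E \<Longrightarrow> \<exists>a b. e = {a, b}"
    using assms(3) by blast
  have Fi: "F i \<subseteq> E" "forest (F i)" "finite (F i)" if "i < k" for i
    using F that \<open>finite E\<close> finite_subset by (auto simp: maximum_packing_def forest_packing_def)
  have conn_D: "conn (F i \<inter> D) x y \<longleftrightarrow> conn D x y" if i: "i < k" for i x y
  proof
    show "conn (F i \<inter> D) x y" if "conn D x y"
      using that
    proof (rule conn_closed)
      fix a b assume "{a, b} \<in> D"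
      then obtain G where "(exchange k E)\<^sup>*\<^sup>* F G" "{a, b} \<in> unused k E G"
        unfolding D_def exchange_edges_def by blast
      then show "conn (F i \<inter> D) a b"
        unfolding D_def
        using conn_unused_exchange_edges conn_before_exchanges F i \<open>finite E\<close> edge by metis
    qed
  qed (auto intro: conn_mono)
  have count: "card (comps V (F i)) + card (F i - D) = card ?P" if i: "i < k" for i
  proof -
    have "(F i \<inter> D) \<union> (F i - D) = F i"
      by blast
    moreover have "comps V (F i \<inter> D) = ?P"
      using conn_D[OF i] by (simp add: comps_def)
    moreover have "card (comps V ((F i \<inter> D) \<union> (F i - D))) + card (F i - D)
        = card (comps V (F i \<inter> D))"
      by (rule card_comps_forest) (use assms(1,3) Fi[OF i] in \<open>auto simp: Int_Diff_Un\<close>)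
    ultimately show ?thesis by simp
  qed
  have pos: "card (comps V A) \<ge> 1" for A
    using assms(1,2) by (simp add: Suc_le_eq card_gt_0_iff) (simp add: comps_def)
  have "{e \<in> E. \<not> (\<exists>X\<in>?P. e \<subseteq> X)} \<subseteq> (\<Union>i<k. F i - D)"
  proof
    fix e assume "e \<in> {e \<in> E. \<not> (\<exists>X\<in>?P. e \<subseteq> X)}"
    then have e: "e \<in> E" "\<not> (\<exists>X\<in>?P. e \<subseteq> X)"
      by auto
    obtain a b where ab: "e = {a, b}" "a \<in> V" "b \<in> V"
      using e(1) assms(3)[of e] by auto
    have "e \<notin> D"
    proof
      assume "e \<in> D"
      then have "e \<subseteq> {y \<in> V. conn D a y}"
        using ab by (auto intro: conn_edge)
      then show False
        using e(2) ab(2) by (auto simp: comps_def)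
    qed
    moreover have "unused k E F \<subseteq> D"
      unfolding D_def exchange_edges_def by blast
    ultimately show "e \<in> (\<Union>i<k. F i - D)"
      using e(1) by (auto simp: unused_def)
  qed
  then have "card {e \<in> E. \<not> (\<exists>X\<in>?P. e \<subseteq> X)} \<le> card (\<Union>i<k. F i - D)"
    using Fi by (intro card_mono) auto
  also have "\<dots> \<le> (\<Sum>i<k. card (F i - D))"
    by (rule card_UN_le) simp
  finally have "k * (card ?P - 1) \<le> (\<Sum>i<k. card (F i - D))"
    using crossing[OF partition_on_comps, of D] by linarith
  moreover have le: "card (F i - D) \<le> card ?P - 1" if "i < k" for i
    using count[OF that] pos[of "F i"] by linarith
  then have "(\<Sum>i<k. card (F i - D)) \<le> (\<Sum>i<k. card ?P - 1)"
    by (intro sum_mono) auto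
  ultimately have "(\<Sum>i<k. card (F i - D)) = (\<Sum>i<k. card ?P - 1)"
    by simp
  then have "card (F i - D) = card ?P - 1" if "i < k" for i
    using sum_mono_inv[of "\<lambda>i. card (F i - D)" "{..<k}" "\<lambda>i. card ?P - 1" i] that le by auto
  then have one: "card (comps V (F i)) = 1" if "i < k" for i
    using count[OF that] that pos[of D] by fastforce
  show thesis
  proof
    show "forest_packing k E F"
      using F by (simp add: maximum_packing_def)
    show "conn (F i) x y" if "i < k" "x \<in> V" "y \<in> V" for i x y
    proof -
      have "{z \<in> V. conn (F i) x z} \<in> comps V (F i)" "{z \<in> V. conn (F i) y z} \<in> comps V (F i)"
        using that by (auto simp: comps_def)
      then have "{z \<in> V. conn (F i) x z} = {z \<in> V. conn (F i) y z}"
        using one[OF that(1)] by (metis card_1_singletonE singletonD)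
      then show ?thesis
        using comps_eq_iff[OF that(2,3)] by blast
    qed
    show "card (F i) = card V - 1" if "i < k" for i
      using card_comps_forest[of V "F i" "{}"] assms(1,3) Fi[OF that] one[OF that]
      by (fastforce simp: card_comps_empty)
  qed
qed

lemma tau_le:
  assumes "finite V" "partition_on V P" "card P \<ge> 2"
  shows "tau V E \<le> real (card {e \<in> E. \<not> (\<exists>X\<in>P. e \<subseteq> X)}) / (real (card P) - 1)"
proof -
  let ?r = "\<lambda>P. real (size (quotient_edges E P)) / (real (card P) - 1)"
  have "{?r P | P. partition_on V P \<and> card P \<ge> 2} \<subseteq> ?r ` {P. partition_on V P}"
    by blast
  then have "finite {?r P | P. partition_on V P \<and> card P \<ge> 2}"
    using finitely_many_partition_on[OF assms(1)] finite_surj by blast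
  then have "tau V E \<le> ?r P"
    unfolding tau_def using assms(2,3) by (intro Min_le) auto
  then show ?thesis
    by (simp add: quotient_edges_def)
qed

lemma tau_imp_crossing:
  assumes "finite V" "partition_on V P" "tau V E \<ge> real k"
  shows "k * (card P - 1) \<le> card {e \<in> E. \<not> (\<exists>X\<in>P. e \<subseteq> X)}"
proof (cases "card P \<ge> 2")
  case True
  have "real k \<le> real (card {e \<in> E. \<not> (\<exists>X\<in>P. e \<subseteq> X)}) / (real (card P) - 1)"
    using tau_le[OF assms(1,2) True, of E] assms(3) by linarith
  then have "real k * (real (card P) - 1) \<le> real (card {e \<in> E. \<not> (\<exists>X\<in>P. e \<subseteq> X)})"
    using True by (simp add: pos_le_divide_eq)
  then have "real (k * (card P - 1)) \<le> real (card {e \<in> E. \<not> (\<exists>X\<in>P. e \<subseteq> X)})"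
    using True by (simp add: of_nat_diff)
  then show ?thesis
    by (simp only: of_nat_le_iff)
next
  case False
  then have "card P - 1 = 0" by linarith
  then show ?thesis by (metis mult_0_right zero_le)
qed

section \<open>The coloring by spanning trees\<close>

theorem RMC_coloring_of_tree_packing:
  assumes "fin_simple_graph V E" "forest_packing k E F"
    and "\<And>i x y. i < k \<Longrightarrow> x \<in> V \<Longrightarrow> y \<in> V \<Longrightarrow> conn (F i) x y"
    and "\<And>i e. i < k \<Longrightarrow> e \<in> F i \<Longrightarrow> c e = i"
  shows "RMC_coloring k V E c"
  unfolding RMC_coloring_def
proof (intro ballI impI)
  fix u v assume uv: "u \<in> V" "v \<in> V" "u \<noteq> v"
  have F: "F i \<subseteq> E" if "i < k" for i
    using assms(2) that by (simp add: forest_packing_def)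
  have sub: "e \<subseteq> V" if "i < k" "e \<in> F i" for i e
    using assms(1) F[OF that(1)] that(2) unfolding fin_simple_graph_def by blast
  have "\<exists>p. uv_path V (F i) u p v" if "i < k" for i
    using conn_imp_uv_path[of "F i" u v V] assms(3) that uv sub by blast
  then obtain p where p: "\<And>i. i < k \<Longrightarrow> uv_path V (F i) u (p i) v"
    by metis
  have pe: "path_edges (p i) \<subseteq> F i" "path_edges (p i) \<noteq> {}" if "i < k" for i
    using p[OF that] uv(3) path_edges_nonempty by (auto simp: uv_path_def)
  have mono: "monochromatic c (p i)" if "i < k" for i
    unfolding monochromatic_def using pe(1)[OF that] assms(4)[OF that] by (metis subsetD)
  have col: "path_color c (p i) = i" if i: "i < k" for i
  proof -
    obtain e where "e \<in> path_edges (p i)"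
      using pe(2)[OF i] by blast
    then show ?thesis
      using path_color_eq[OF _ mono[OF i]] assms(4)[OF i] pe(1)[OF i] by (metis subsetD)
  qed
  have "inj_on p {..<k}"
    by (metis col inj_onI lessThan_iff)
  then have "card (p ` {..<k}) = k"
    by (simp add: card_image)
  moreover have "rainbow_mono_paths V E c u v (p ` {..<k})"
    unfolding rainbow_mono_paths_def
  proof (intro conjI ballI impI)
    fix q assume "q \<in> p ` {..<k}"
    then obtain i where i: "i < k" "q = p i" by blast
    show "uv_path V E u q v"
      using p[OF i(1)] F[OF i(1)] i(2) by (auto simp: uv_path_def)
    show "monochromatic c q"
      using mono i by blast
    fix q' assume "q' \<in> p ` {..<k}" "q \<noteq> q'"
    then obtain j where j: "j < k" "q' = p j" "i \<noteq> j"
      using i by blast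
    have "F i \<inter> F j = {}"
      using assms(2) i j unfolding forest_packing_def by blast
    then show "path_edges q \<inter> path_edges q' = {}"
      using pe(1)[OF i(1)] pe(1)[OF j(1)] i j by blast
    show "path_color c q \<noteq> path_color c q'"
      using col i j by metis
  qed
  ultimately show "\<exists>S. finite S \<and> k \<le> card S \<and> rainbow_mono_paths V E c u v S"
    by (intro exI[of _ "p ` {..<k}"]) simp
qed

theorem exists_RMC_coloring:
  assumes "fin_simple_graph V E" "card V \<ge> 2" "tau V E \<ge> real k"
  obtains c where "RMC_coloring k V E c"
    "int (card (c ` E)) = int (card E) - int k * (int (card V) - 2)"
proof -
  have V: "finite V" "V \<noteq> {}"
    using assms(1,2) by (auto simp: fin_simple_graph_def)
  note E = fin_simple_graph_edge[OF assms(1)]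
  have "finite E"
    by (rule fin_simple_graph_finite_edges[OF assms(1)])
  obtain F where F: "forest_packing k E F"
      "\<And>i x y. i < k \<Longrightarrow> x \<in> V \<Longrightarrow> y \<in> V \<Longrightarrow> conn (F i) x y"
      "\<And>i. i < k \<Longrightarrow> card (F i) = card V - 1"
    using exists_spanning_tree_packing[of V E k] V E tau_imp_crossing[OF V(1) _ assms(3)] by blast
  have Fi: "F i \<subseteq> E" "finite (F i)" if "i < k" for i
  proof -
    show "F i \<subseteq> E"
      using F(1) that by (simp add: forest_packing_def)
    then show "finite (F i)"
      using \<open>finite E\<close> by (rule finite_subset)
  qed
  define T where "T = (\<Union>i<k. F i)"
  have "T \<subseteq> E"
    using Fi by (auto simp: T_def)
  have "card T = (\<Sum>i<k. card (F i))"
    unfolding T_def using F(1) Fi by (intro card_UN_disjoint) (auto simp: forest_packing_def)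
  then have card_T: "card T = k * (card V - 1)"
    using F(3) by simp
  obtain g :: "'a set \<Rightarrow> nat" where g: "inj_on g E"
    using finite_imp_inj_to_nat_seg[OF \<open>finite E\<close>] by metis
  \<comment> \<open>The trees use the colors below \<open>k\<close>; all other edges have private colors from \<open>k\<close> on.\<close>
  define c where "c e = (if e \<in> T then THE i. i < k \<and> e \<in> F i else k + g e)" for e
  have c: "c e = i" if "i < k" "e \<in> F i" for i e
  proof -
    have "(THE i. i < k \<and> e \<in> F i) = i"
      using that F(1) unfolding forest_packing_def by (intro the_equality) blast+
    then show ?thesis
      using that by (auto simp: c_def T_def)
  qed
  have "RMC_coloring k V E c"
    using assms(1) F(1,2) c by (rule RMC_coloring_of_tree_packing)
  moreover have "c ` T = {..<k}"
  proof (intro equalityI subsetI)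
    fix i assume "i \<in> {..<k}"
    then have "card (F i) \<noteq> 0"
      using F(3)[of i] assms(2) by simp
    then obtain e where "e \<in> F i"
      by fastforce
    then show "i \<in> c ` T"
      using c \<open>i \<in> {..<k}\<close> by (force simp: T_def)
  qed (auto simp: T_def c)
  moreover have "inj_on c (E - T)"
    using g by (auto simp: inj_on_def c_def)
  then have "card (c ` (E - T)) = card E - card T"
    using \<open>T \<subseteq> E\<close> \<open>finite E\<close> by (simp add: card_image card_Diff_subset finite_subset)
  moreover have "c ` T \<inter> c ` (E - T) = {}"
    using \<open>c ` T = {..<k}\<close> by (auto simp: c_def)
  moreover have "c ` E = c ` T \<union> c ` (E - T)"
    using \<open>T \<subseteq> E\<close> by blast
  ultimately have "card (c ` E) = k + (card E - k * (card V - 1))"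
    using \<open>finite E\<close> \<open>T \<subseteq> E\<close> card_T by (simp add: card_Un_disjoint finite_subset)
  moreover have "k * (card V - 1) \<le> card E"
    using card_mono[OF \<open>finite E\<close> \<open>T \<subseteq> E\<close>] card_T by simp
  ultimately have "int (card (c ` E)) = int (card E) - int k * (int (card V) - 2)"
    using assms(2) by (simp add: of_nat_diff algebra_simps)
  then show thesis
    using \<open>RMC_coloring k V E c\<close> that by blast
qed

section \<open>An upper bound on the number of colors\<close>

lemma RMC_coloring_colors:
  assumes "RMC_coloring k V E c" "u \<in> V" "v \<in> V" "u \<noteq> v"
  shows "\<exists>K \<subseteq> c ` E. card K = k \<and> (\<forall>i\<in>K. conn {e \<in> E. c e = i} u v)"
proof -
  obtain S where S: "finite S" "card S \<ge> k" "rainbow_mono_paths V E c u v S"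
    using assms unfolding RMC_coloring_def by blast
  have path: "path_color c p \<in> c ` E \<and> conn {e \<in> E. c e = path_color c p} u v" if "p \<in> S" for p
  proof -
    have p: "uv_path V E u p v" "monochromatic c p"
      using S(3) that by (auto simp: rainbow_mono_paths_def)
    then have sub: "path_edges p \<subseteq> {e \<in> E. c e = path_color c p}"
      using path_color_eq by (fastforce simp: uv_path_def)
    moreover obtain e where "e \<in> path_edges p"
      using p(1) assms(4) path_edges_nonempty unfolding uv_path_def by blast
    ultimately have "path_color c p \<in> c ` E"
      by (metis (mono_tags, lifting) imageI mem_Collect_eq subsetD)
    moreover have "conn {e \<in> E. c e = path_color c p} u v"
      using sub p(1) path_imp_conn unfolding uv_path_def by metis
    ultimately show ?thesis ..
  qed
  have "inj_on (path_color c) S"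
    using S(3) unfolding rainbow_mono_paths_def inj_on_def by blast
  then have "k \<le> card (path_color c ` S)"
    using S(2) by (simp add: card_image)
  then obtain K where "K \<subseteq> path_color c ` S" "card K = k"
    by (meson obtain_subset_with_card_n)
  then show ?thesis
    using path by (intro exI[of _ K]) blast
qed

text \<open>
  The form of all upper bounds below. A color class with \<open>j\<close> edges costs \<open>j - 1\<close> colors in
  comparison with the coloring in which all edges differ. If \<open>k\<close> colors are assigned to each
  vertex of \<open>W\<close> such that no color is assigned more often than it costs, then at least
  \<open>k * card W\<close> colors are lost.
\<close>

lemma card_colors_bound:
  assumes "finite E" "finite W" "\<And>x. x \<in> W \<Longrightarrow> K x \<subseteq> c ` E \<and> card (K x) = k"
    and "\<And>i. i \<in> c ` E \<Longrightarrow> card {x \<in> W. i \<in> K x} < card {e \<in> E. c e = i}"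
  shows "card (c ` E) + k * card W \<le> card E"
proof -
  have "(\<Sum>i\<in>c ` E. card {x \<in> W. i \<in> K x}) = (\<Sum>x\<in>W. k)"
  proof (rule sum_multicount_gen)
    show "\<forall>x\<in>W. card {i \<in> c ` E. i \<in> K x} = k"
      using assms(3) by (metis Collect_mem_eq Int_absorb1 Int_def)
  qed (use assms in auto)
  then have "card (c ` E) + k * card W = (\<Sum>i\<in>c ` E. Suc (card {x \<in> W. i \<in> K x}))"
    by (simp add: sum_Suc)
  also have "\<dots> \<le> (\<Sum>i\<in>c ` E. card {e \<in> E. c e = i})"
    using assms(4) by (intro sum_mono Suc_leI)
  also have "\<dots> = card E"
    using sum.image_gen[OF assms(1), of "\<lambda>_. 1::nat" c] by simp
  finally show ?thesis .
qed

lemma card_class_ge: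
  assumes "fin_simple_graph V E" "finite X" "X \<inter> R = {}"
    "\<And>x. x \<in> X \<Longrightarrow> \<exists>r\<in>R. conn {e \<in> E. c e = i} r x"
  shows "card X \<le> card {e \<in> E. c e = i}"
  by (rule card_reached_le_card_edges)
    (use assms fin_simple_graph_edge[OF assms(1)] fin_simple_graph_finite_edges[OF assms(1)] in auto)

lemma color_class_pos:
  assumes "finite E" "i \<in> c ` E"
  shows "0 < card {e \<in> E. c e = i}"
  using assms by (auto simp: card_gt_0_iff)

subsection \<open>Two vertices without a common neighbor\<close>

text \<open>
  Every further vertex is nonadjacent to \<open>u\<close> or to \<open>w\<close> and is assigned \<open>k\<close> colors that join
  it to this one. In a color that joins \<open>u\<close> to \<open>w\<close>, one edge is left over since \<open>w\<close> has to be
  reached from \<open>u\<close> as well. Any other color that is assigned via \<open>u\<close> reaches a neighbor \<open>y\<close>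
  of \<open>u\<close> to which it is not assigned: not via \<open>u\<close>, since \<open>y\<close> is adjacent to \<open>u\<close>, and not via
  \<open>w\<close>, since the color would then join \<open>u\<close> to \<open>w\<close>. The same holds with \<open>u\<close> and \<open>w\<close>
  exchanged.
\<close>

lemma card_colors_no_common_neighbor:
  assumes "fin_simple_graph V E" "RMC_coloring k V E c" "u \<in> V" "w \<in> V" "u \<noteq> w"
    and no_common: "\<And>x. \<not> ({u, x} \<in> E \<and> {x, w} \<in> E)"
  shows "card (c ` E) + k * (card V - 2) \<le> card E"
proof -
  let ?cl = "\<lambda>i. {e \<in> E. c e = i}"
  define r where "r x = (if {u, x} \<notin> E then u else w)" for x
  have r: "r x = u \<and> {u, x} \<notin> E \<or> r x = w \<and> {w, x} \<notin> E" for x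
    using no_common[of x] by (auto simp: r_def insert_commute)
  let ?W = "V - {u, w}"
  have "\<exists>K. K \<subseteq> c ` E \<and> card K = k \<and> (\<forall>i\<in>K. conn (?cl i) (r x) x)" if "x \<in> ?W" for x
    using RMC_coloring_colors[OF assms(2), of "r x" x] assms(3,4) that r[of x] by auto
  then obtain K where K: "\<And>x. x \<in> ?W \<Longrightarrow>
      K x \<subseteq> c ` E \<and> card (K x) = k \<and> (\<forall>i\<in>K x. conn (?cl i) (r x) x)"
    by metis
  have finV: "finite V"
    using assms(1) by (simp add: fin_simple_graph_def)
  have finE: "finite E"
    using assms(1) by (rule fin_simple_graph_finite_edges)
  have "card {x \<in> ?W. i \<in> K x} < card (?cl i)" if i: "i \<in> c ` E" for i
  proof -
    let ?X = "{x \<in> ?W. i \<in> K x}"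
    have X: "conn (?cl i) (r x) x" if "x \<in> ?X" for x
      using K that by blast
    have finX: "finite ?X"
      using finV by simp
    consider "?X = {}" | "conn (?cl i) u w" | x where "x \<in> ?X" "\<not> conn (?cl i) u w"
      by blast
    then show ?thesis
    proof cases
      case 1
      then show ?thesis using color_class_pos[OF finE i] by (simp only: card.empty)
    next
      case 2
      have "card (insert w ?X) \<le> card (?cl i)"
      proof (rule card_class_ge[OF assms(1)])
        fix x assume "x \<in> insert w ?X"
        then show "\<exists>r\<in>{u}. conn (?cl i) r x"
          using X[of x] r[of x] 2 conn_trans by auto
      qed (use finX assms(5) in auto)
      then show ?thesis
        using finX by simp
    next
      case (3 x)
      then have "{r x, x} \<notin> E" "r x \<in> {u, w}" "r x \<noteq> x"
        using r[of x] by auto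
      obtain y where y: "{r x, y} \<in> ?cl i"
        by (rule conn_imp_boundary_edge[OF X[OF 3(1)], of "{r x}"]) (use \<open>r x \<noteq> x\<close> in auto)
      have ry: "conn (?cl i) (r x) y"
        using y by (rule conn_edge)
      have "y \<noteq> r x"
        using y fin_simple_graph_def assms(1) by fastforce
      then have "y \<notin> {u, w}"
        using ry 3(2) \<open>r x \<in> {u, w}\<close> conn_sym by (metis insertE singletonD)
      have "y \<notin> ?X"
      proof
        assume yX: "y \<in> ?X"
        have "r y \<noteq> r x"
          using r[of y] y assms(5) by auto
        moreover have "conn (?cl i) (r y) (r x)"
          using conn_trans[OF X[OF yX] conn_sym[OF ry]] .
        then have "conn (?cl i) (r x) (r y)"
          by (rule conn_sym)
        ultimately show False
          using \<open>conn (?cl i) (r y) (r x)\<close> 3(2) \<open>r x \<in> {u, w}\<close> r[of y] by auto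
      qed
      moreover have "card (insert y ?X) \<le> card (?cl i)"
      proof (rule card_class_ge[OF assms(1)])
        fix z assume "z \<in> insert y ?X"
        then show "\<exists>r\<in>{u, w}. conn (?cl i) r z"
          using X[of z] r[of z] ry \<open>r x \<in> {u, w}\<close> by auto
      qed (use finX \<open>y \<notin> {u, w}\<close> in auto)
      ultimately show ?thesis
        using finX by simp
    qed
  qed
  then have "card (c ` E) + k * card ?W \<le> card E"
    using K finV finE by (intro card_colors_bound[where K = K]) auto
  moreover have "card ?W = card V - 2"
    using assms(3-5) finV by (simp add: card_Diff_subset)
  ultimately show ?thesis by simp
qed

lemma triangle_free_no_common_neighbor:
  assumes "fin_simple_graph V E" "triangle_free E" "{u, w} \<in> E"
  shows "\<not> ({u, x} \<in> E \<and> {x, w} \<in> E)"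
proof
  assume x: "{u, x} \<in> E \<and> {x, w} \<in> E"
  have "a \<noteq> b" if "{a, b} \<in> E" for a b
    using assms(1) that by (auto simp: fin_simple_graph_def)
  then have "distinct [u, x, w]"
    using x assms(3) by auto
  then show False
    using x assms(2,3) unfolding triangle_free_def by blast
qed

lemma diam_no_common_neighbor:
  assumes "fin_simple_graph V E" "graph_diam V E \<ge> 3"
  obtains u w where "u \<in> V" "w \<in> V" "u \<noteq> w" "\<And>x. \<not> ({u, x} \<in> E \<and> {x, w} \<in> E)"
proof -
  have "\<exists>u\<in>V. \<exists>w\<in>V. \<not> graph_dist V E u w \<le> 2"
  proof (rule ccontr)
    assume "\<not> ?thesis"
    then have "graph_diam V E \<le> 2"
      unfolding graph_diam_def by (intro SUP_least) blast
    then have "(3::enat) \<le> 2"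
      using assms(2) by (rule order_trans[rotated])
    then show False by simp
  qed
  then obtain u w where uw: "u \<in> V" "w \<in> V" "\<not> graph_dist V E u w \<le> 2"
    by blast
  have long: "\<not> length p \<le> 3" if "uv_path V E u p w" for p
  proof
    assume "length p \<le> 3"
    then have "enat (length p - 1) \<le> enat 2"
      by simp
    moreover have "graph_dist V E u w \<le> enat (length p - 1)"
      unfolding graph_dist_def using that by (intro INF_lower) simp
    ultimately show False
      using uw(3) by (metis numeral_eq_enat order_trans)
  qed
  have ne: "u \<noteq> w"
    using long[of "[u]"] uw by (auto simp: uv_path_def)
  have "\<not> ({u, x} \<in> E \<and> {x, w} \<in> E)" for x
  proof
    assume x: "{u, x} \<in> E \<and> {x, w} \<in> E"
    then have "x \<in> V" "u \<noteq> x" "x \<noteq> w"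
      using assms(1) by (auto simp: fin_simple_graph_def)
    then have "uv_path V E u [u, x, w] w"
      using x uw ne by (auto simp: uv_path_def)
    then show False
      using long by fastforce
  qed
  then show thesis
    using that uw ne by blast
qed

subsection \<open>Cut vertices\<close>

lemma graph_components_eq_comps:
  assumes "\<And>e. e \<in> E \<Longrightarrow> e \<subseteq> V"
  shows "graph_components V E = comps V E"
proof -
  have "(\<exists>p. uv_path V E u p v) \<longleftrightarrow> conn E u v" if "u \<in> V" "v \<in> V" for u v
    using uv_path_imp_conn[of V E u _ v] conn_imp_uv_path[of E u v V] assms that by metis
  then have "{v \<in> V. \<exists>p. uv_path V E u p v} = {v \<in> V. conn E u v}" if "u \<in> V" for u
    using that by (intro Collect_cong) auto
  then show ?thesis
    unfolding graph_components_def comps_def Setcompr_eq_image by (intro image_cong) auto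
qed

lemma cut_vertex_separates:
  assumes "fin_simple_graph V E" "cut_vertex V E v"
  obtains u w where "u \<in> V - {v}" "w \<in> V - {v}" "\<not> conn {e \<in> E. v \<notin> e} u w"
proof -
  let ?E = "{e \<in> E. v \<notin> e}"
  have V: "finite V" "v \<in> V" "card (graph_components (V - {v}) ?E) > card (graph_components V E)"
    using assms by (auto simp: fin_simple_graph_def cut_vertex_def)
  have sub: "e \<subseteq> V" if "e \<in> E" for e
    using fin_simple_graph_edge[OF assms(1) that] by blast
  have "comps V E \<noteq> {}"
    using V by (auto simp: comps_def)
  then have "card (graph_components V E) \<ge> 1"
    using V(1) sub by (simp add: graph_components_eq_comps Suc_le_eq card_gt_0_iff)
  moreover have "graph_components (V - {v}) ?E = comps (V - {v}) ?E"
    using sub by (intro graph_components_eq_comps) auto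
  ultimately have card: "card (comps (V - {v}) ?E) > 1"
    using V(3) by simp
  have "\<exists>u\<in>V - {v}. \<exists>w\<in>V - {v}. \<not> conn ?E u w"
  proof (rule ccontr)
    assume "\<not> ?thesis"
    then have "{y \<in> V - {v}. conn ?E x y} = V - {v}" if "x \<in> V - {v}" for x
      using that by blast
    then have "comps (V - {v}) ?E \<subseteq> {V - {v}}"
      unfolding comps_def by blast
    then have "card (comps (V - {v}) ?E) \<le> card {V - {v}}"
      by (intro card_mono) auto
    then show False
      using card by simp
  qed
  then show thesis
    using that by blast
qed

lemma conn_through_separator:
  assumes "conn B x w" "x \<in> X" "w \<notin> X"
    and "\<And>a b. {a, b} \<in> B \<Longrightarrow> a \<in> X \<Longrightarrow> b \<in> insert v X"
  shows "conn B x v"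
proof -
  have "w \<in> X \<or> conn B x v"
    using assms(1)
  proof (induction rule: conn_induct)
    case (step y z)
    then show ?case
      using assms(4)[of y z] conn_edge conn_trans by (metis insertE)
  qed (simp add: assms(2))
  then show ?thesis
    using assms(3) by blast
qed

text \<open>
  Fix vertices \<open>u\<close> and \<open>w\<close> that \<open>v\<close> separates. A vertex on the side of \<open>u\<close> is assigned \<open>k\<close>
  colors that join it to \<open>w\<close>, and any other vertex \<open>k\<close> colors that join it to \<open>u\<close>. These
  paths pass through \<open>v\<close>, so the vertices that are assigned a color \<open>i\<close> lie in the component
  of \<open>v\<close> in this color. One more vertex of the component is not assigned \<open>i\<close>: either \<open>u\<close>, which
  is assigned no colors at all, or else only vertices on the side of \<open>u\<close> are assigned \<open>i\<close>, and
  \<open>w\<close> is in the component.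
\<close>

lemma card_colors_cut_vertex:
  assumes "fin_simple_graph V E" "RMC_coloring k V E c" "cut_vertex V E v"
  shows "card (c ` E) + k * (card V - 2) \<le> card E"
proof -
  let ?cl = "\<lambda>i. {e \<in> E. c e = i}"
  let ?E = "{e \<in> E. v \<notin> e}"
  obtain u w where uw: "u \<in> V - {v}" "w \<in> V - {v}" "\<not> conn ?E u w"
    using cut_vertex_separates[OF assms(1,3)] .
  define X where "X = {x \<in> V - {v}. conn ?E u x}"
  define Y where "Y = V - {v} - X"
  have mem: "u \<in> X" "w \<in> Y" "X \<inter> Y = {}" "V - {v} = X \<union> Y" "v \<notin> X" "v \<notin> Y"
    using uw by (auto simp: X_def Y_def)
  have stepX: "b \<in> insert v X" if "{a, b} \<in> E" "a \<in> X" for a b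
  proof -
    have "b \<in> V"
      using fin_simple_graph_edge[OF assms(1) that(1)] by blast
    moreover have "conn ?E u b" if "b \<noteq> v"
    proof -
      have "conn ?E a b"
        using \<open>{a, b} \<in> E\<close> \<open>a \<in> X\<close> that by (intro conn_edge) (auto simp: X_def)
      moreover have "conn ?E u a"
        using \<open>a \<in> X\<close> by (simp add: X_def)
      ultimately show ?thesis
        by (rule conn_trans[rotated])
    qed
    ultimately show ?thesis
      by (auto simp: X_def)
  qed
  have stepY: "b \<in> insert v Y" if "{a, b} \<in> E" "a \<in> Y" for a b
  proof -
    have "b \<in> V"
      using fin_simple_graph_edge[OF assms(1) that(1)] by blast
    moreover have "b \<notin> X"
      using stepX[of b a] that mem by (auto simp: insert_commute)
    ultimately show ?thesis
      by (auto simp: Y_def)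
  qed
  have through: "conn (?cl i) v x \<and> conn (?cl i) v y"
    if "conn (?cl i) x y" "x \<in> X" "y \<in> Y" for i x y
  proof -
    have "y \<notin> X" "x \<notin> Y"
      using that(2,3) mem(3) by blast+
    have "conn (?cl i) x v"
      by (rule conn_through_separator[OF that(1,2) \<open>y \<notin> X\<close>]) (use stepX in blast)
    moreover have "conn (?cl i) y v"
      by (rule conn_through_separator[OF conn_sym[OF that(1)] that(3) \<open>x \<notin> Y\<close>])
        (use stepY in blast)
    ultimately show ?thesis
      using conn_sym by metis
  qed
  let ?W = "V - {v, u}"
  let ?joins = "\<lambda>x i. conn (?cl i) v x \<and> (x \<in> X \<longrightarrow> conn (?cl i) v w) \<and>
      (x \<in> Y \<longrightarrow> conn (?cl i) v u)"
  let ?good = "\<lambda>x K. K \<subseteq> c ` E \<and> card K = k \<and> (\<forall>i\<in>K. ?joins x i)"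
  have "\<exists>K. ?good x K" if "x \<in> ?W" for x
  proof (cases "x \<in> X")
    case True
    then obtain K where "K \<subseteq> c ` E" "card K = k" "\<forall>i\<in>K. conn (?cl i) x w"
      using RMC_coloring_colors[OF assms(2), of x w] that uw(2) mem by auto
    then show ?thesis
      using through[of _ x w] True mem by (intro exI[of _ K]) blast
  next
    case False
    then have "x \<in> Y" "x \<noteq> u" "x \<in> V"
      using that mem by auto
    then obtain K where "K \<subseteq> c ` E" "card K = k" "\<forall>i\<in>K. conn (?cl i) u x"
      using RMC_coloring_colors[OF assms(2), of u x] uw(1) by auto
    then show ?thesis
      using through[of _ u x] False \<open>x \<in> Y\<close> mem by (intro exI[of _ K]) blast
  qed
  then have "\<exists>K. \<forall>x\<in>?W. ?good x (K x)"
    by (intro bchoice) blast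
  then obtain K where K: "\<forall>x\<in>?W. ?good x (K x)" ..
  have finV: "finite V"
    using assms(1) by (simp add: fin_simple_graph_def)
  have finE: "finite E"
    using assms(1) by (rule fin_simple_graph_finite_edges)
  have "card {x \<in> ?W. i \<in> K x} < card (?cl i)" if i: "i \<in> c ` E" for i
  proof -
    let ?Z = "{x \<in> ?W. i \<in> K x}"
    have Z: "?joins x i" if "x \<in> ?Z" for x
      using K that by blast
    have finZ: "finite ?Z"
      using finV by simp
    consider "?Z = {}" | "conn (?cl i) v u" | x where "x \<in> ?Z" "\<not> conn (?cl i) v u"
      by blast
    then show ?thesis
    proof cases
      case 1
      then show ?thesis using color_class_pos[OF finE i] by (simp only: card.empty)
    next
      case 2
      have "card (insert u ?Z) \<le> card (?cl i)"
        by (rule card_class_ge[OF assms(1), of _ "{v}"]) (use finZ uw(1) Z 2 in auto)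
      then show ?thesis
        using finZ by simp
    next
      case (3 x)
      have "z \<in> X" if "z \<in> ?Z" for z
        using Z[OF that] 3(2) that mem by blast
      then have "w \<notin> ?Z" "conn (?cl i) v w"
        using mem 3(1) Z[of x] by auto
      moreover have "card (insert w ?Z) \<le> card (?cl i)"
        by (rule card_class_ge[OF assms(1), of _ "{v}"]) (use finZ uw(2) Z calculation in auto)
      ultimately show ?thesis
        using finZ by simp
    qed
  qed
  then have "card (c ` E) + k * card ?W \<le> card E"
    using K finV finE by (intro card_colors_bound[where K = K]) auto
  moreover have "v \<in> V"
    using assms(3) by (simp add: cut_vertex_def)
  then have "card ?W = card V - 2"
    using uw(1) finV by (auto simp: card_Diff_subset)
  ultimately show ?thesis by simp
qed

subsection \<open>Small edge cuts\<close>

text \<open>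
  Any two vertices on different sides of a cut by at most \<open>k\<close> edges are joined in \<open>k\<close> colors,
  each of which occurs in the cut. So there are exactly \<open>k\<close> colors in the cut, and each of them
  joins every vertex of one side to every vertex of the other, hence spans the graph.
\<close>

lemma card_colors_edge_cut:
  assumes "fin_simple_graph V E" "RMC_coloring k V E c" "card V \<ge> 2"
    and "\<not> edge_connected (k + 1) V E"
  shows "card (c ` E) + k * (card V - 2) \<le> card E"
proof -
  let ?cl = "\<lambda>i. {e \<in> E. c e = i}"
  have finV: "finite V"
    using assms(1) by (simp add: fin_simple_graph_def)
  have finE: "finite E"
    using assms(1) by (rule fin_simple_graph_finite_edges)
  have sub: "e \<subseteq> V" if "e \<in> E" for e
    using fin_simple_graph_edge[OF assms(1) that] by blast
  obtain C where C: "C \<subseteq> E" "card C \<le> k" "\<not> graph_connected V (E - C)"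
    using assms(3,4) by (auto simp: edge_connected_def)
  then obtain u v where uv: "u \<in> V" "v \<in> V" "\<not> (\<exists>p. uv_path V (E - C) u p v)"
    using assms(3) by (auto simp: graph_connected_def)
  then have not_conn: "\<not> conn (E - C) u v"
    using conn_imp_uv_path[of "E - C" u v V] sub by blast
  define X where "X = {x \<in> V. conn (E - C) u x}"
  have mem: "u \<in> X" "v \<notin> X"
    using uv not_conn by (auto simp: X_def)
  have finC: "finite C"
    using C(1) finE by (rule finite_subset)
  have crossing: "i \<in> c ` C" if xy: "conn (?cl i) x y" "x \<in> X" "y \<notin> X" for i x y
  proof -
    obtain a b where ab: "{a, b} \<in> ?cl i" "a \<in> X" "b \<notin> X"
      using conn_imp_boundary_edge[OF xy] by blast
    have "{a, b} \<in> C"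
    proof (rule ccontr)
      assume "{a, b} \<notin> C"
      then have "conn (E - C) a b"
        using ab(1) by (intro conn_edge) simp
      moreover have "conn (E - C) u a"
        using ab(2) by (simp add: X_def)
      ultimately have "conn (E - C) u b"
        by (rule conn_trans[rotated])
      moreover have "b \<in> V"
        using ab(1) sub[of "{a, b}"] by simp
      ultimately show False
        using ab(3) by (simp add: X_def)
    qed
    then show ?thesis
      using ab(1) by auto
  qed
  have colors: "card (c ` C) = k \<and> (\<forall>i\<in>c ` C. conn (?cl i) x y)"
    if xy: "x \<in> X" "y \<in> V - X" for x y
  proof -
    obtain K where K: "card K = k" "\<forall>i\<in>K. conn (?cl i) x y"
      using RMC_coloring_colors[OF assms(2), of x y] xy by (auto simp: X_def)
    then have "K \<subseteq> c ` C"
      using crossing xy by blast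
    moreover have "card (c ` C) \<le> k"
      using card_image_le[OF finC, of c] C(2) by linarith
    ultimately have "K = c ` C"
      using K(1) finC by (intro card_seteq) auto
    then show ?thesis
      using K by simp
  qed
  have spanning: "conn (?cl i) u x" if i: "i \<in> c ` C" and x: "x \<in> V" for i x
  proof (cases "x \<in> X")
    case True
    then have "conn (?cl i) u v" "conn (?cl i) x v"
      using colors mem uv(2) i by blast+
    then show ?thesis
      by (rule conn_trans[OF _ conn_sym])
  next
    case False
    then show ?thesis
      using colors[of u x] mem(1) i x by blast
  qed
  let ?W = "V - {u, v}"
  have cardW: "card ?W = card V - 2"
  proof -
    have "u \<noteq> v"
      using mem by blast
    then show ?thesis
      using uv(1,2) finV by (simp add: card_Diff_subset)
  qed
  have "card {x \<in> ?W. i \<in> c ` C} < card (?cl i)" if i: "i \<in> c ` E" for i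
  proof (cases "i \<in> c ` C")
    case True
    have "card (V - {u}) \<le> card (?cl i)"
      by (rule card_class_ge[OF assms(1), of _ "{u}"]) (use finV spanning[OF True] in auto)
    moreover have "card (V - {u}) = Suc (card ?W)"
      using finV uv(1) cardW assms(3) by simp
    moreover have "{x \<in> ?W. i \<in> c ` C} = ?W"
      using True by blast
    ultimately show ?thesis
      by (simp only: Suc_le_eq)
  next
    case False
    then have "{x \<in> ?W. i \<in> c ` C} = {}"
      by blast
    then show ?thesis
      using color_class_pos[OF finE i] by (simp only: card.empty)
  qed
  then have "card (c ` E) + k * card ?W \<le> card E"
    using colors mem uv(2) C(1) finV finE
    by (intro card_colors_bound[where K = "\<lambda>_. c ` C"]) auto
  then show ?thesis
    by (simp add: cardW)
qed

section \<open>The value of \<open>rmc\<close>\<close>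

lemma card_colors_le:
  assumes "k \<ge> 1" "fin_simple_graph V E" "card V \<ge> 2" "RMC_coloring k V E c"
    and "triangle_free E \<or> graph_diam V E \<ge> 3 \<or> (\<exists>v. cut_vertex V E v)
      \<or> \<not> edge_connected (k + 1) V E"
  shows "card (c ` E) + k * (card V - 2) \<le> card E"
  using assms(5)
proof (elim disjE exE)
  assume "triangle_free E"
  \<comment> \<open>The ends of any edge have no common neighbor.\<close>
  obtain a b where ab: "a \<in> V" "b \<in> V" "a \<noteq> b"
    using assms(3) by (metis card_le_Suc0_iff_eq card.infinite not_less_eq_eq numeral_2_eq_2
        zero_le)
  obtain K i where "card K = k" "i \<in> K" "conn {e \<in> E. c e = i} a b"
    using RMC_coloring_colors[OF assms(4) ab] assms(1)
    by (metis card.empty equals0I not_one_le_zero)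
  then obtain u w where uw: "{u, w} \<in> E"
    using conn_imp_boundary_edge[of "{e \<in> E. c e = i}" a b "{a}"] ab(3) by blast
  then have "u \<in> V" "w \<in> V" "u \<noteq> w"
    using assms(2) by (auto simp: fin_simple_graph_def)
  then show ?thesis
    using card_colors_no_common_neighbor[OF assms(2,4)]
      triangle_free_no_common_neighbor[OF assms(2) \<open>triangle_free E\<close> uw] by blast
next
  assume "graph_diam V E \<ge> 3"
  then obtain u w where "u \<in> V" "w \<in> V" "u \<noteq> w" "\<And>x. \<not> ({u, x} \<in> E \<and> {x, w} \<in> E)"
    using diam_no_common_neighbor[OF assms(2)] by metis
  then show ?thesis
    by (rule card_colors_no_common_neighbor[OF assms(2,4)])
next
  fix v assume "cut_vertex V E v"
  then show ?thesis
    by (rule card_colors_cut_vertex[OF assms(2,4)])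
next
  assume "\<not> edge_connected (k + 1) V E"
  then show ?thesis
    by (rule card_colors_edge_cut[OF assms(2,4,3)])
qed

theorem theorem4p1:
  fixes V :: "'a set" and E :: "'a set set" and k n m :: nat
  assumes "k \<ge> 1"
    and "fin_simple_graph V E"
    and "n = card V" and "n \<ge> 2"
    and "m = card E"
    and "tau V E \<ge> real k"
    and "triangle_free E
         \<or> graph_diam V E \<ge> 3
         \<or> (\<exists>v. cut_vertex V E v)
         \<or> \<not> edge_connected (k + 1) V E"
  shows "int (rmc k V E) = int m - int k * (int n - 2)"
proof -
  have n: "card V \<ge> 2"
    using assms(3,4) by simp
  have "finite E"
    using assms(2) by (rule fin_simple_graph_finite_edges)
  obtain c where c: "RMC_coloring k V E c"
      "int (card (c ` E)) = int (card E) - int k * (int (card V) - 2)"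
    using exists_RMC_coloring[OF assms(2) n assms(6)] .
  have "card (d ` E) \<le> card (c ` E)" if "RMC_coloring k V E d" for d
  proof -
    have "card (d ` E) + k * (card V - 2) \<le> card E"
      using card_colors_le[OF assms(1,2) n that assms(7)] .
    then have "int (card (d ` E) + k * (card V - 2)) \<le> int (card E)"
      by (simp only: of_nat_le_iff)
    then show ?thesis
      using c(2) n by (simp add: of_nat_diff)
  qed
  moreover have "finite {card (d ` E) | d. RMC_coloring k V E d}"
    by (rule finite_subset[of _ "{..card E}"]) (auto intro: card_image_le[OF \<open>finite E\<close>])
  ultimately have "rmc k V E = card (c ` E)"
    unfolding rmc_def using c(1) by (intro Max_eqI) auto
  then show ?thesis
    using c(2) assms(3,5) by simp
qed

end
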